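(* Let $M$ be a four-dimensional smooth spacetime manifold with Lorentzian metric $g_{ab}$, and let $\mathcal{S}\subset M$ be a closed, connected, orientable, smoothly embedded spacelike 2-surface which has a time and space orientable open neighbourhood in $M$. Let $U\subset M$ be an open, time and space orientable neighbourhood of $\mathcal{S}$ which is foliated by smooth spacelike hypersurfaces $\Sigma_t$, $t\in(-\tau,\tau)$ for some $\tau>0$, such that the leaves are homeomorphic to $\mathcal{S}\times(-\epsilon,\epsilon)$ for some $\epsilon>0$, $\mathcal{S}$ is embedded in $\Sigma_0$ as $\mathcal{S}\times\{0\}$, and $U$ is homeomorphic to $\mathcal{S}\times(-\epsilon,\epsilon)\times(-\tau,\tau)$. Then any $SL(2,\mathbb{C})$ principal fibre bundle over $U$ is globally trivializable.
   Context: Closed means compact without boundary. An open set $W\subset M$ is called time and space orientable if time and space orientations can be chosen continuously on all of $W$, so that the bundle of orthonormal frames over $W$ reduces to a principal $SO_0(1,3)$-bundle, where $SO_0(1,3)$ is the identity component of the Lorentz group $O(1,3)$. A principal bundle is globally trivializable if it admits a global cross section (equivalently, it is isomorphic to a product bundle). *)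

theory Defs
  imports "HOL-Analysis.Analysis"
begin

section \<open>Smooth maps between Euclidean spaces\<close>

text \<open>Meant for open \<open>S\<close>: all iterated directional derivatives exist, are continuous, and are
  differentiable at every point of \<open>S\<close>.\<close>

primrec Ck_on :: "nat \<Rightarrow> 'v::real_normed_vector set \<Rightarrow> ('v \<Rightarrow> 'w::real_normed_vector) \<Rightarrow> bool" where
  "Ck_on 0 S f \<longleftrightarrow> continuous_on S f"
| "Ck_on (Suc k) S f \<longleftrightarrow> (\<forall>x\<in>S. f differentiable (at x)) \<and>
     (\<forall>v. Ck_on k S (\<lambda>x. frechet_derivative f (at x) v))"

definition smooth_on :: "'v::real_normed_vector set \<Rightarrow> ('v \<Rightarrow> 'w::real_normed_vector) \<Rightarrow> bool" where
  "smooth_on S f \<longleftrightarrow> (\<forall>k. Ck_on k S f)"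


section \<open>Smooth manifolds\<close>

text \<open>A chart is a pair of a coordinate domain and a coordinate map.\<close>

type_synonym ('a, 'n) chart = "'a set \<times> ('a \<Rightarrow> real ^ 'n)"

definition chart_inv :: "('a, 'n::finite) chart \<Rightarrow> real ^ 'n \<Rightarrow> 'a" where
  "chart_inv c = inv_into (fst c) (snd c)"

definition is_chart :: "'a topology \<Rightarrow> ('a, 'n::finite) chart \<Rightarrow> bool" where
  "is_chart M c \<longleftrightarrow> openin M (fst c) \<and> open (snd c ` fst c) \<and>
     homeomorphic_map (subtopology M (fst c)) (top_of_set (snd c ` fst c)) (snd c)"

definition smooth_transition :: "('a, 'n::finite) chart \<Rightarrow> ('a, 'n) chart \<Rightarrow> bool" where
  "smooth_transition c d \<longleftrightarrow> smooth_on (snd c ` (fst c \<inter> fst d)) (snd d \<circ> chart_inv c)"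

definition smooth_manifold :: "'a topology \<Rightarrow> ('a, 'n::finite) chart set \<Rightarrow> bool" where
  "smooth_manifold M A \<longleftrightarrow> Hausdorff_space M \<and> second_countable M \<and>
     (\<forall>c\<in>A. is_chart M c) \<and> topspace M = (\<Union>c\<in>A. fst c) \<and>
     (\<forall>c\<in>A. \<forall>d\<in>A. smooth_transition c d)"

text \<open>The charts of the smooth structure (maximal atlas) generated by the atlas \<open>A\<close>.\<close>

definition smooth_chart :: "'a topology \<Rightarrow> ('a, 'n::finite) chart set \<Rightarrow> ('a, 'n) chart \<Rightarrow> bool" where
  "smooth_chart M A c \<longleftrightarrow> is_chart M c \<and>
     (\<forall>d\<in>A. smooth_transition c d \<and> smooth_transition d c)"

text \<open>Jacobian matrix at \<open>p\<close> of the change of coordinates from \<open>c\<close> to \<open>d\<close>.\<close>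

definition jacobian_at ::
    "('a, 'n::finite) chart \<Rightarrow> ('a, 'n) chart \<Rightarrow> 'a \<Rightarrow> real ^ 'n ^ 'n" where
  "jacobian_at c d p = matrix (frechet_derivative (snd d \<circ> chart_inv c) (at (snd c p)))"


section \<open>Lorentzian metrics and orthonormal frames\<close>

text \<open>Signature convention \<open>(+,-,-,-)\<close>; the index type \<open>4\<close> has the elements 0, 1, 2, 3.\<close>

definition minkowski :: "real ^ 4 ^ 4" where
  "minkowski = (\<chi> i j. if i \<noteq> j then 0 else if i = 0 then 1 else - 1)"

definition O13 :: "(real ^ 4 ^ 4) set" where
  "O13 = {L. transpose L ** minkowski ** L = minkowski}"

definition SO0_13 :: "(real ^ 4 ^ 4) set" where
  "SO0_13 = connected_component_set O13 (mat 1)"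

text \<open>A metric is given by its components \<open>g c p\<close> at \<open>p\<close> with respect to each chart \<open>c\<close> of the
  atlas around \<open>p\<close>; these are smooth, transform as a covariant 2-tensor, and admit a basis
  (the columns of \<open>E\<close>) in which they take the Minkowskian form.\<close>

definition lorentzian_metric ::
    "('a, 4) chart set \<Rightarrow> (('a, 4) chart \<Rightarrow> 'a \<Rightarrow> real ^ 4 ^ 4) \<Rightarrow> bool" where
  "lorentzian_metric A g \<longleftrightarrow>
     (\<forall>c\<in>A. smooth_on (snd c ` fst c) (\<lambda>x. g c (chart_inv c x))) \<and>
     (\<forall>c\<in>A. \<forall>p\<in>fst c. transpose (g c p) = g c p \<and>
        (\<exists>E. invertible E \<and> transpose E ** g c p ** E = minkowski)) \<and>
     (\<forall>c\<in>A. \<forall>d\<in>A. \<forall>p\<in>fst c \<inter> fst d.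
        g c p = transpose (jacobian_at c d p) ** g d p ** jacobian_at c d p)"

text \<open>An orthonormal frame at \<open>p\<close> is likewise given by its components: column \<open>a\<close> of \<open>E c\<close> holds
  the components of the \<open>a\<close>-th frame vector in the chart \<open>c\<close>. The value 0 on charts not
  containing \<open>p\<close> makes the representation unique.\<close>

definition orthonormal_frames ::
    "('a, 4) chart set \<Rightarrow> (('a, 4) chart \<Rightarrow> 'a \<Rightarrow> real ^ 4 ^ 4) \<Rightarrow> 'a \<Rightarrow>
     (('a, 4) chart \<Rightarrow> real ^ 4 ^ 4) set" where
  "orthonormal_frames A g p = {E.
     (\<forall>c\<in>A. p \<in> fst c \<longrightarrow> transpose (E c) ** g c p ** E c = minkowski) \<and>
     (\<forall>c\<in>A. \<forall>d\<in>A. p \<in> fst c \<inter> fst d \<longrightarrow> E d = jacobian_at c d p ** E c) \<and>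
     (\<forall>c. \<not> (c \<in> A \<and> p \<in> fst c) \<longrightarrow> E c = 0)}"

text \<open>The two time and two space orientations at \<open>p\<close> correspond to the four \<open>SO0_13\<close>-orbits of
  orthonormal frames at \<open>p\<close>. A continuous choice \<open>Q\<close> of such orbits over \<open>W\<close>, i.e. one admitting
  continuous local frame fields with values in \<open>Q\<close>, is exactly a reduction of the bundle of
  orthonormal frames over \<open>W\<close> to a principal \<open>SO0_13\<close>-bundle.\<close>

definition time_space_orientable ::
    "'a topology \<Rightarrow> ('a, 4) chart set \<Rightarrow> (('a, 4) chart \<Rightarrow> 'a \<Rightarrow> real ^ 4 ^ 4) \<Rightarrow> 'a set \<Rightarrow> bool" where
  "time_space_orientable M A g W \<longleftrightarrow> (\<exists>Q.
     (\<forall>p\<in>W. \<exists>E\<in>orthonormal_frames A g p. Q p = {(\<lambda>c. E c ** L) | L. L \<in> SO0_13}) \<and>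
     (\<forall>p\<in>W. \<exists>V e. openin M V \<and> p \<in> V \<and> V \<subseteq> W \<and> (\<forall>q\<in>V. e q \<in> Q q) \<and>
        (\<forall>c\<in>A. continuous_map (subtopology M (V \<inter> fst c)) euclidean (\<lambda>q. e q c))))"


section \<open>Embedded submanifolds and foliations\<close>

text \<open>A smooth local parametrization of \<open>S\<close>: an immersion \<open>F\<close> of an open \<open>W\<close> into the manifold that
  is a homeomorphism onto a relatively open subset of \<open>S\<close>.\<close>

definition local_param ::
    "'a topology \<Rightarrow> ('a, 'n::finite) chart set \<Rightarrow> 'a set \<Rightarrow>
     (real ^ 'k::finite) set \<Rightarrow> (real ^ 'k \<Rightarrow> 'a) \<Rightarrow> bool" where
  "local_param M A S W F \<longleftrightarrow> open W \<and> openin (subtopology M S) (F ` W) \<and>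
     homeomorphic_map (top_of_set W) (subtopology M (F ` W)) F \<and>
     (\<forall>c\<in>A. smooth_on {u \<in> W. F u \<in> fst c} (snd c \<circ> F) \<and>
        (\<forall>u\<in>W. F u \<in> fst c \<longrightarrow> inj (frechet_derivative (snd c \<circ> F) (at u))))"

text \<open>The first argument, used as \<open>TYPE('k)\<close>, carries the dimension of the submanifold.\<close>

definition embedded_submanifold ::
    "'k::finite itself \<Rightarrow> 'a topology \<Rightarrow> ('a, 'n::finite) chart set \<Rightarrow> 'a set \<Rightarrow> bool" where
  "embedded_submanifold _ M A S \<longleftrightarrow> S \<subseteq> topspace M \<and>
     (\<forall>p\<in>S. \<exists>W (F :: real ^ 'k \<Rightarrow> 'a). local_param M A S W F \<and> p \<in> F ` W)"

definition orientable_submanifold ::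
    "'k::finite itself \<Rightarrow> 'a topology \<Rightarrow> ('a, 'n::finite) chart set \<Rightarrow> 'a set \<Rightarrow> bool" where
  "orientable_submanifold _ M A S \<longleftrightarrow>
     (\<exists>B :: ((real ^ 'k) set \<times> (real ^ 'k \<Rightarrow> 'a)) set.
        (\<forall>(W, F)\<in>B. local_param M A S W F) \<and> S = (\<Union>(W, F)\<in>B. F ` W) \<and>
        (\<forall>(W, F)\<in>B. \<forall>(W', F')\<in>B. \<forall>u\<in>W. F u \<in> F' ` W' \<longrightarrow>
           det (matrix (frechet_derivative (inv_into W' F' \<circ> F) (at u))) > 0))"

text \<open>With signature \<open>(+,-,-,-)\<close>, spacelike means that the induced metric is negative definite.
  The vectors \<open>w\<close> below range over the components of the nonzero tangent vectors of \<open>S\<close>.\<close>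

definition spacelike_submanifold ::
    "'k::finite itself \<Rightarrow> 'a topology \<Rightarrow> ('a, 4) chart set \<Rightarrow>
     (('a, 4) chart \<Rightarrow> 'a \<Rightarrow> real ^ 4 ^ 4) \<Rightarrow> 'a set \<Rightarrow> bool" where
  "spacelike_submanifold k M A g S \<longleftrightarrow> embedded_submanifold k M A S \<and>
     (\<forall>W (F :: real ^ 'k \<Rightarrow> 'a). local_param M A S W F \<longrightarrow>
        (\<forall>c\<in>A. \<forall>u\<in>W. \<forall>v. F u \<in> fst c \<and> v \<noteq> 0 \<longrightarrow>
           (let w = frechet_derivative (snd c \<circ> F) (at u) v in w \<bullet> (g c (F u) *v w) < 0)))"

text \<open>A smooth codimension-one foliation of \<open>U\<close> with embedded leaves \<open>\<Sigma> t\<close>, \<open>t \<in> I\<close>: around every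
  point there is a flat chart, i.e. a smooth chart onto an open box in which every leaf is a
  countable (possibly empty) union of slices \<open>x $ 0 = const\<close>.\<close>

definition hypersurface_foliation ::
    "'a topology \<Rightarrow> ('a, 4) chart set \<Rightarrow> 'a set \<Rightarrow> 'i set \<Rightarrow> ('i \<Rightarrow> 'a set) \<Rightarrow> bool" where
  "hypersurface_foliation M A U I \<Sigma> \<longleftrightarrow>
     (\<forall>t\<in>I. \<Sigma> t \<noteq> {} \<and> connectedin M (\<Sigma> t) \<and> embedded_submanifold TYPE(3) M A (\<Sigma> t)) \<and>
     disjoint_family_on \<Sigma> I \<and> (\<Union>t\<in>I. \<Sigma> t) = U \<and>
     (\<forall>p\<in>U. \<exists>c a b. smooth_chart M A c \<and> p \<in> fst c \<and> fst c \<subseteq> U \<and> snd c ` fst c = box a b \<and>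
        (\<forall>t\<in>I. \<exists>C. countable C \<and>
           snd c ` (fst c \<inter> \<Sigma> t) = {x \<in> snd c ` fst c. x $ 0 \<in> C}))"


section \<open>Principal bundles\<close>

text \<open>The structure group is given by its topology \<open>G\<close> (with carrier \<open>topspace G\<close>),
  multiplication and unit. It acts on the total space \<open>P\<close> from the right.\<close>

definition principal_bundle ::
    "'g topology \<Rightarrow> ('g \<Rightarrow> 'g \<Rightarrow> 'g) \<Rightarrow> 'g \<Rightarrow> 'p topology \<Rightarrow> 'b topology \<Rightarrow>
     ('p \<Rightarrow> 'b) \<Rightarrow> ('p \<Rightarrow> 'g \<Rightarrow> 'p) \<Rightarrow> bool" where
  "principal_bundle G mul one P B \<pi> act \<longleftrightarrow>
     continuous_map P B \<pi> \<and>
     continuous_map (prod_topology P G) P (\<lambda>(p, a). act p a) \<and>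
     (\<forall>p\<in>topspace P. act p one = p) \<and>
     (\<forall>p\<in>topspace P. \<forall>a\<in>topspace G. \<forall>b\<in>topspace G. act p (mul a b) = act (act p a) b) \<and>
     (\<forall>x\<in>topspace B. \<exists>V \<Psi>. openin B V \<and> x \<in> V \<and>
        homeomorphic_map (prod_topology (subtopology B V) G)
          (subtopology P {p \<in> topspace P. \<pi> p \<in> V}) \<Psi> \<and>
        (\<forall>y\<in>V. \<forall>a\<in>topspace G. \<pi> (\<Psi> (y, a)) = y \<and>
           (\<forall>b\<in>topspace G. \<Psi> (y, mul a b) = act (\<Psi> (y, a)) b)))"

definition globally_trivializable :: "'p topology \<Rightarrow> 'b topology \<Rightarrow> ('p \<Rightarrow> 'b) \<Rightarrow> bool" where
  "globally_trivializable P B \<pi> \<longleftrightarrow>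
     (\<exists>s. continuous_map B P s \<and> (\<forall>x\<in>topspace B. \<pi> (s x) = x))"

definition SL2C :: "(complex ^ 2 ^ 2) set" where
  "SL2C = {a. det a = 1}"

abbreviation SL2C_bundle ::
    "'p topology \<Rightarrow> 'b topology \<Rightarrow> ('p \<Rightarrow> 'b) \<Rightarrow> ('p \<Rightarrow> complex ^ 2 ^ 2 \<Rightarrow> 'p) \<Rightarrow> bool" where
  "SL2C_bundle \<equiv> principal_bundle (top_of_set SL2C) (**) (mat 1)"

end

theory Submission
  imports Defs
begin

text \<open>The neighbourhood retracts onto the surface, and \<open>SL(2,\<complex>)\<close> is homeomorphic to
  \<open>S\<^sup>3 \<times> \<real>\<^sup>3\<close>, hence 2-connected, so there is no obstruction to a section over a surface. To avoid
  triangulating the surface, cover it by finitely many closed coordinate discs: a section over the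
  first few of them extends over the next one because a map from a closed subset of a plane disc to
  the 3-sphere extends to the whole disc. The section over the surface is then transported along
  the fibres of the product by a covering homotopy, over an exhaustion of the open rectangle by
  compact ones.\<close>

section \<open>Extending maps into \<open>SL(2,\<complex>)\<close>\<close>

text \<open>The discs already treated meet the next one in an arbitrary closed set without any cell
  structure. Vanishing homotopy groups only extend maps from the boundary of a disc, so they do not
  apply directly; what is used is that maps into the 3-sphere extend from every closed subset of a
  ball of dimension at most 3. The contractible factor of the group is left to Tietze. Lifting a
  homotopy by finitely many local moves needs a compact parameter space, whereas the rectangle is
  open. The lifts over the compact stages must therefore agree exactly where they overlap, not just
  up to homotopy. This is why the covering homotopy is proved with the extra clause that a lift
  keeps its value wherever the homotopy is stationary.\<close>

lemma extend_to_sphere_dim_less: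
  fixes A C :: "'e::euclidean_space set" and f :: "'e \<Rightarrow> 'f::euclidean_space"
  assumes dim: "DIM('e) < DIM('f)" and "closed A" "A \<subseteq> C" "bounded C"
    and f: "continuous_on A f" "f ` A \<subseteq> sphere 0 1"
  obtains g where "continuous_on C g" "g ` C \<subseteq> sphere 0 1" "\<And>x. x \<in> A \<Longrightarrow> g x = f x"
proof -
  obtain a where a: "C \<subseteq> cbox (- a) a"
    using bounded_subset_cbox_symmetric \<open>bounded C\<close> by blast
  have T: "rel_frontier (cball 0 1 :: 'f set) = sphere 0 1" by simp
  \<comment> \<open>The cube counts as a cell complex with one cell. Extending over a cell into the
    frontier of a ball requires the cell to have smaller dimension than the ball, and
    \<open>dim\<close> grants this even for the full cube.\<close>
  have dim': "aff_dim X < aff_dim (cball 0 1 :: 'f set)" if "X \<in> {cbox (- a) a}" for X :: "'e set"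
  proof -
    have "aff_dim X \<le> int DIM('e)" by (rule aff_dim_le_DIM)
    also have "\<dots> < aff_dim (cball 0 1 :: 'f set)" using dim by (simp add: aff_dim_cball)
    finally show ?thesis .
  qed
  obtain g where g: "continuous_on (\<Union>{cbox (- a) a}) g" "g \<in> \<Union>{cbox (- a) a} \<rightarrow> sphere 0 1"
      "\<And>x. x \<in> A \<Longrightarrow> g x = f x"
  proof (rule extend_map_cell_complex_to_sphere[of "{cbox (- a) a}" A "cball 0 1 :: 'f set" f, unfolded T])
    show "X \<inter> Y face_of X" if "X \<in> {cbox (- a) a}" "Y \<in> {cbox (- a) a}" for X Y
      using that by (simp add: face_of_refl)
  qed (use assms a dim' polytope_interval in auto)
  show thesis
  proof
    show "continuous_on C g" using g(1) a continuous_on_subset by fastforce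
    show "g ` C \<subseteq> sphere 0 1" using g(2) a by auto
  qed (use g in auto)
qed

lemma Tietze_compact:
  fixes f :: "'e::euclidean_space \<Rightarrow> 'f::euclidean_space"
  assumes "compact A" "A \<subseteq> C" "continuous_on A f"
  shows "\<exists>g. continuous_on C g \<and> (\<forall>x\<in>A. g x = f x)"
proof -
  have "bounded (f ` A)" using assms compact_continuous_image compact_imp_bounded by blast
  then obtain b where b: "b > 0" "\<And>x. x \<in> A \<Longrightarrow> norm (f x) \<le> b" by (auto simp: bounded_pos)
  have "closedin (top_of_set C) A"
    using assms by (simp add: closed_subset compact_imp_closed)
  then obtain g where "continuous_on C g" "\<And>x. x \<in> A \<Longrightarrow> g x = f x"
    using Tietze[OF assms(3) _ less_imp_le[OF b(1)] b(2)] by blast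
  then show ?thesis by blast
qed

lemma continuous_on_vec_if:
  assumes "continuous_on S f" "continuous_on S g"
  shows "continuous_on S (\<lambda>x. \<chi> i. if P i then f x else g x)"
proof (rule continuous_on_vec_lambda)
  show "continuous_on S (\<lambda>x. if P i then f x else g x)" for i
    using assms by (cases "P i") simp_all
qed

text \<open>\<open>SL(2,\<complex>)\<close> fibres over \<open>\<complex>\<^sup>2 - {0}\<close> by taking the first row. The first row extends by radial
  projection to the 3-sphere; a second row extended by Tietze is then corrected by a multiple of
  \<open>(- cnj z\<^sub>2, cnj z\<^sub>1) / \<bar>z\<bar>\<^sup>2\<close>, whose determinant with the first row \<open>z\<close> is 1.\<close>

lemma SL2C_extension:
  fixes A C :: "'e::euclidean_space set"
  assumes dim: "DIM('e) \<le> 3" and A: "closed A" "A \<subseteq> C" and C: "compact C"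
    and f: "continuous_map (top_of_set A) (top_of_set SL2C) f"
  obtains g where "continuous_map (top_of_set C) (top_of_set SL2C) g" "\<And>x. x \<in> A \<Longrightarrow> g x = f x"
proof -
  have cA: "compact A" using A C closed_subset compact_Int_closed inf.absorb2 by metis
  have fc: "continuous_on A f" and fS: "\<And>x. x \<in> A \<Longrightarrow> f x \<in> SL2C"
    using f by (auto simp: continuous_map_in_subtopology)
  have det: "f x $ 1 $ 1 * f x $ 2 $ 2 - f x $ 1 $ 2 * f x $ 2 $ 1 = 1" if "x \<in> A" for x
    using fS[OF that] by (simp add: SL2C_def det_2)
  have nz: "f x $ 1 \<noteq> 0" if "x \<in> A" for x
    using det[OF that] by auto
  obtain u :: "'e \<Rightarrow> complex ^ 2" where u: "continuous_on C u" "u ` C \<subseteq> sphere 0 1"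
      "\<And>x. x \<in> A \<Longrightarrow> u x = (inverse (norm (f x $ 1))) *\<^sub>R (f x $ 1)"
  proof (rule extend_to_sphere_dim_less)
    \<comment> \<open>Over the reals \<open>complex ^ 2\<close> has dimension 4, which is where the
      bound 3 on the domain comes from.\<close>
    show "DIM('e) < DIM(complex ^ 2)" using dim by simp
    show "continuous_on A (\<lambda>x. (inverse (norm (f x $ 1))) *\<^sub>R (f x $ 1))"
      by (intro continuous_intros fc) (use nz in auto)
    show "(\<lambda>x. (inverse (norm (f x $ 1))) *\<^sub>R (f x $ 1)) ` A \<subseteq> sphere 0 1"
      using nz by auto
  qed (use A C compact_imp_bounded in auto)
  \<comment> \<open>The length of the row is extended through its logarithm, so that
    \<open>exp (r x)\<close> stays positive and the extended row \<open>z\<close> never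
    vanishes.\<close>
  have lnc: "continuous_on A (\<lambda>x. ln (norm (f x $ 1)))"
    by (intro continuous_intros fc) (use nz in auto)
  obtain r :: "'e \<Rightarrow> real" where r: "continuous_on C r" "\<And>x. x \<in> A \<Longrightarrow> r x = ln (norm (f x $ 1))"
    using Tietze_compact[OF cA A(2) lnc] by blast
  have fc2: "continuous_on A (\<lambda>x. f x $ 2)" by (intro continuous_intros fc)
  obtain w :: "'e \<Rightarrow> complex ^ 2" where w: "continuous_on C w" "\<And>x. x \<in> A \<Longrightarrow> w x = f x $ 2"
    using Tietze_compact[OF cA A(2) fc2] by blast
  define z where "z x = exp (r x) *\<^sub>R u x" for x
  \<comment> \<open>\<open>d\<close> is the determinant of the provisional matrix with rows
    \<open>z\<close> and \<open>w\<close>. Adding \<open>1 - d\<close> times \<open>v\<close> to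
    \<open>w\<close> raises it by exactly \<open>1 - d\<close>; on \<open>A\<close>, where
    \<open>d\<close> is already 1, nothing changes.\<close>
  define d where "d x = z x $ 1 * w x $ 2 - z x $ 2 * w x $ 1" for x
  \<comment> \<open>As \<open>u\<close> is a unit vector, \<open>z\<close> has norm
    \<open>exp (r x)\<close>, so dividing by its square leaves the factor
    \<open>exp (- r x)\<close>.\<close>
  define v where "v x = exp (- r x) *\<^sub>R
      ((\<chi> i. if i = 1 then - cnj (u x $ 2) else cnj (u x $ 1)) :: complex ^ 2)" for x
  define g :: "'e \<Rightarrow> complex ^ 2 ^ 2"
    where "g x = (\<chi> i. if i = 1 then z x else w x + (1 - d x) *s v x)" for x
  have z1: "z x = f x $ 1" if "x \<in> A" for x
    using nz[OF that] that by (simp add: z_def u r)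
  have u1: "u x $ 1 * cnj (u x $ 1) + u x $ 2 * cnj (u x $ 2) = 1" if "x \<in> C" for x
  proof -
    have "norm (u x) = 1" using u(2) that by auto
    then have "(cmod (u x $ 1))\<^sup>2 + (cmod (u x $ 2))\<^sup>2 = 1"
      by (simp add: norm_vec_def L2_set_def sum_2 real_sqrt_eq_1_iff)
    then show ?thesis
      unfolding complex_norm_square[symmetric] by (metis of_real_1 of_real_add)
  qed
  have zv: "z x $ 1 * v x $ 2 - z x $ 2 * v x $ 1 = 1" if "x \<in> C" for x
  proof -
    have "z x $ 1 * v x $ 2 - z x $ 2 * v x $ 1
        = of_real (exp (r x) * exp (- r x)) * (u x $ 1 * cnj (u x $ 1) + u x $ 2 * cnj (u x $ 2))"
      unfolding z_def v_def vector_scaleR_component scaleR_conv_of_real[where 'a = complex]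
      by (simp add: algebra_simps)
    then show ?thesis using u1[OF that] by (simp add: exp_minus)
  qed
  show thesis
  proof
    have "continuous_on C z" unfolding z_def by (intro continuous_intros r u)
    moreover have "continuous_on C v" unfolding v_def
      by (intro continuous_intros r u continuous_on_vec_if)
    moreover have "continuous_on C d" unfolding d_def by (intro continuous_intros calculation w)
    ultimately have gc: "continuous_on C g" unfolding g_def vector_scalar_mult_def
      by (intro continuous_intros continuous_on_vec_if w)
    have "det (g x) = 1" if "x \<in> C" for x
    proof -
      have "det (g x) = d x + (1 - d x) * (z x $ 1 * v x $ 2 - z x $ 2 * v x $ 1)"
        by (simp add: det_2 g_def d_def algebra_simps)
      then show ?thesis using zv[OF that] by simp
    qed
    then show "continuous_map (top_of_set C) (top_of_set SL2C) g"
      using gc by (auto simp: continuous_map_in_subtopology SL2C_def)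
    show "g x = f x" if "x \<in> A" for x
    proof -
      have "d x = 1" using det[OF that] by (simp add: d_def z1 w that)
      then show ?thesis using that by (simp add: g_def vec_eq_iff forall_2 z1 w)
    qed
  qed
qed

section \<open>Lifting maps to the total space of a locally trivial bundle\<close>

text \<open>The fibre coordinate \<open>\<phi>\<close> is recorded apart from the chart
  \<open>\<Psi>\<close>, because a lift is moved by reading off \<open>\<phi>\<close> and feeding it
  to \<open>\<Psi>\<close> over a different base point.\<close>

definition local_trivialization ::
    "'g topology \<Rightarrow> 'p topology \<Rightarrow> 'b topology \<Rightarrow> ('p \<Rightarrow> 'b) \<Rightarrow> 'b set \<Rightarrow>
     ('b \<times> 'g \<Rightarrow> 'p) \<Rightarrow> ('p \<Rightarrow> 'g) \<Rightarrow> bool" where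
  "local_trivialization G P B \<pi> V \<Psi> \<phi> \<longleftrightarrow> openin B V \<and>
     continuous_map (prod_topology (subtopology B V) G) P \<Psi> \<and>
     continuous_map (subtopology P {p \<in> topspace P. \<pi> p \<in> V}) G \<phi> \<and>
     (\<forall>y\<in>V. \<forall>a\<in>topspace G. \<pi> (\<Psi> (y, a)) = y) \<and>
     (\<forall>p\<in>topspace P. \<pi> p \<in> V \<longrightarrow> \<Psi> (\<pi> p, \<phi> p) = p)"

definition locally_trivial ::
    "'g topology \<Rightarrow> 'p topology \<Rightarrow> 'b topology \<Rightarrow> ('p \<Rightarrow> 'b) \<Rightarrow> bool" where
  "locally_trivial G P B \<pi> \<longleftrightarrow>
     (\<forall>x\<in>topspace B. \<exists>V \<Psi> \<phi>. x \<in> V \<and> local_trivialization G P B \<pi> V \<Psi> \<phi>)"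

text \<open>For \<open>k\<close> the identity this is a section. A variable base map is what allows
  a section to be carried through a homotopy.\<close>

definition lifts ::
    "'x topology \<Rightarrow> 'p topology \<Rightarrow> ('p \<Rightarrow> 'b) \<Rightarrow> ('x \<Rightarrow> 'b) \<Rightarrow> ('x \<Rightarrow> 'p) \<Rightarrow> bool" where
  "lifts X P \<pi> k s \<longleftrightarrow> continuous_map X P s \<and> (\<forall>x\<in>topspace X. \<pi> (s x) = k x)"

lemma locally_trivialE:
  assumes "locally_trivial G P B \<pi>" "x \<in> topspace B"
  obtains V \<Psi> \<phi> where "x \<in> V" "local_trivialization G P B \<pi> V \<Psi> \<phi>"
  using bspec[OF assms(1)[unfolded locally_trivial_def] assms(2)] by (elim exE conjE)

text \<open>The fibre coordinate is the second component of the inverse of \<open>\<Psi>\<close>;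
  the first component has to be \<open>\<pi> p\<close> because \<open>\<Psi>\<close> maps
  \<open>(y, a)\<close> into the fibre over \<open>y\<close>.\<close>

lemma principal_bundle_imp_locally_trivial:
  assumes "principal_bundle G mul one P B \<pi> act"
  shows "locally_trivial G P B \<pi>"
  unfolding locally_trivial_def
proof
  fix x assume x: "x \<in> topspace B"
  have "\<forall>x\<in>topspace B. \<exists>V \<Psi>. openin B V \<and> x \<in> V \<and>
      homeomorphic_map (prod_topology (subtopology B V) G)
        (subtopology P {p \<in> topspace P. \<pi> p \<in> V}) \<Psi> \<and>
      (\<forall>y\<in>V. \<forall>a\<in>topspace G. \<pi> (\<Psi> (y, a)) = y \<and>
         (\<forall>b\<in>topspace G. \<Psi> (y, mul a b) = act (\<Psi> (y, a)) b))"
    using assms unfolding principal_bundle_def by (elim conjE)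
  from bspec[OF this x] obtain V \<Psi> where V: "openin B V" "x \<in> V" and hom: "homeomorphic_map
      (prod_topology (subtopology B V) G) (subtopology P {p \<in> topspace P. \<pi> p \<in> V}) \<Psi>"
    and act: "\<forall>y\<in>V. \<forall>a\<in>topspace G. \<pi> (\<Psi> (y, a)) = y \<and>
         (\<forall>b\<in>topspace G. \<Psi> (y, mul a b) = act (\<Psi> (y, a)) b)"
    by (elim exE conjE)
  have \<pi>: "\<pi> (\<Psi> (y, a)) = y" if "y \<in> V" "a \<in> topspace G" for y a
    using act that by simp
  obtain \<Theta> where \<Theta>: "homeomorphic_maps (prod_topology (subtopology B V) G)
      (subtopology P {p \<in> topspace P. \<pi> p \<in> V}) \<Psi> \<Theta>"
    using hom homeomorphic_map_maps by blast
  have c: "continuous_map (subtopology P {p \<in> topspace P. \<pi> p \<in> V}) (prod_topology (subtopology B V) G) \<Theta>"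
    and inv: "\<And>p. p \<in> topspace P \<Longrightarrow> \<pi> p \<in> V \<Longrightarrow> \<Psi> (\<Theta> p) = p"
    using \<Theta> by (auto simp: homeomorphic_maps_def)
  have "\<Psi> (\<pi> p, snd (\<Theta> p)) = p" if p: "p \<in> topspace P" "\<pi> p \<in> V" for p
  proof -
    have "\<Theta> p \<in> topspace (prod_topology (subtopology B V) G)"
      using continuous_map_image_subset_topspace[OF c] p by auto
    then have "fst (\<Theta> p) \<in> V" "snd (\<Theta> p) \<in> topspace G" by auto
    from \<pi>[OF this] inv[OF p] have "\<pi> p = fst (\<Theta> p)" by simp
    with inv[OF p] show ?thesis by simp
  qed
  moreover have "continuous_map (subtopology P {p \<in> topspace P. \<pi> p \<in> V}) G (\<lambda>p. snd (\<Theta> p))"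
    using c by (simp add: continuous_map_pairwise o_def)
  moreover have "continuous_map (prod_topology (subtopology B V) G) P \<Psi>"
    using hom homeomorphic_imp_continuous_map continuous_map_into_fulltopology by blast
  ultimately show "\<exists>V \<Psi> \<phi>. x \<in> V \<and> local_trivialization G P B \<pi> V \<Psi> \<phi>"
    unfolding local_trivialization_def using V \<pi> by (intro exI[of _ V] exI[of _ \<Psi>] exI[of _ "snd \<circ> \<Theta>"]) (auto simp: o_def)
qed

text \<open>Over a trivializing set, lifting amounts to giving a map into the fibre: here the map
  yields the lift, and \<open>local_trivialization_coordinate\<close> goes back.\<close>

lemma local_trivialization_point:
  assumes "local_trivialization G P B \<pi> V \<Psi> \<phi>"
    and "continuous_map X B k" "k ` topspace X \<subseteq> V" "continuous_map X G a"
  shows "lifts X P \<pi> k (\<lambda>x. \<Psi> (k x, a x))"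
proof -
  have "continuous_map X (prod_topology (subtopology B V) G) (\<lambda>x. (k x, a x))"
    using assms by (auto simp: continuous_map_paired continuous_map_in_subtopology)
  then have "continuous_map X P (\<Psi> \<circ> (\<lambda>x. (k x, a x)))"
    using assms(1) continuous_map_compose unfolding local_trivialization_def by blast
  moreover have "\<And>x. x \<in> topspace X \<Longrightarrow> a x \<in> topspace G"
    using assms(4) by (simp add: continuous_map_def Pi_iff)
  ultimately show ?thesis
    using assms by (auto simp: lifts_def o_def local_trivialization_def)
qed

lemma local_trivialization_coordinate:
  assumes "local_trivialization G P B \<pi> V \<Psi> \<phi>" "lifts X P \<pi> k s" "k ` topspace X \<subseteq> V"
  shows "continuous_map X G (\<lambda>x. \<phi> (s x))"
    and "\<And>x. x \<in> topspace X \<Longrightarrow> \<Psi> (k x, \<phi> (s x)) = s x"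
proof -
  have s: "s x \<in> topspace P" "\<pi> (s x) = k x" if "x \<in> topspace X" for x
    using assms(2) that by (auto simp: lifts_def continuous_map_def Pi_iff)
  have "continuous_map X (subtopology P {p \<in> topspace P. \<pi> p \<in> V}) s"
    using assms s by (auto simp: continuous_map_in_subtopology lifts_def)
  then have "continuous_map X G (\<phi> \<circ> s)"
    using assms(1) continuous_map_compose unfolding local_trivialization_def by blast
  then show "continuous_map X G (\<lambda>x. \<phi> (s x))" by (simp add: o_def)
  show "\<Psi> (k x, \<phi> (s x)) = s x" if "x \<in> topspace X" for x
    using assms s[OF that] that unfolding local_trivialization_def by (metis image_subset_iff)
qed

section \<open>Covering homotopy over compact Hausdorff spaces\<close>

lemma lifts_subtopology: "lifts X P \<pi> k s \<Longrightarrow> lifts (subtopology X S) P \<pi> k s"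
  by (simp add: lifts_def continuous_map_from_subtopology)

lemma lifts_compose:
  "\<lbrakk>lifts Y P \<pi> k s; continuous_map X Y f\<rbrakk> \<Longrightarrow> lifts X P \<pi> (\<lambda>x. k (f x)) (\<lambda>x. s (f x))"
  unfolding lifts_def using continuous_map_compose[of X Y f P s]
  by (auto simp: o_def continuous_map_def Pi_iff)

lemma lifts_cong:
  "\<lbrakk>lifts X P \<pi> k s; \<And>x. x \<in> topspace X \<Longrightarrow> k' x = k x\<rbrakk> \<Longrightarrow> lifts X P \<pi> k' s"
  by (simp add: lifts_def)

text \<open>Where the base map changes, the fibre coordinate is kept constant.\<close>

lemma lift_move:
  assumes triv: "local_trivialization G P B \<pi> V \<Psi> \<phi>"
    and k: "continuous_map X B k" "continuous_map X B k'" and s: "lifts X P \<pi> k s"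
    and C: "closedin X C" "k ` C \<subseteq> V" "k' ` C \<subseteq> V"
    and eq: "\<And>x. x \<in> topspace X - C \<Longrightarrow> k' x = k x"
  shows "\<exists>s'. lifts X P \<pi> k' s' \<and> (\<forall>x\<in>topspace X. k' x = k x \<longrightarrow> s' x = s x)"
proof -
  \<comment> \<open>\<open>W\<close> is an open neighbourhood of \<open>C\<close>, and the new
    formula is used on all of it. Off \<open>C\<close> the two base maps coincide, so there the
    formula returns \<open>s\<close>, and the pieces fit together over an open cover.\<close>
  define W where "W = {x \<in> topspace X. k x \<in> V} \<inter> {x \<in> topspace X. k' x \<in> V}"
  have V: "openin B V" using triv by (simp add: local_trivialization_def)
  have W: "openin X W" unfolding W_def
    using k V by (intro openin_Int openin_continuous_map_preimage)
  have CW: "C \<subseteq> W" using C closedin_subset unfolding W_def by fastforce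
  define s' where "s' x = (if x \<in> W then \<Psi> (k' x, \<phi> (s x)) else s x)" for x
  have WV: "k ` topspace (subtopology X W) \<subseteq> V" "k' ` topspace (subtopology X W) \<subseteq> V"
    by (auto simp: W_def)
  note coord = local_trivialization_coordinate[OF triv lifts_subtopology[OF s] WV(1)]
  have lW: "lifts (subtopology X W) P \<pi> k' (\<lambda>x. \<Psi> (k' x, \<phi> (s x)))"
    by (rule local_trivialization_point[OF triv _ WV(2) coord(1)])
      (simp add: k continuous_map_from_subtopology)
  have same: "s' x = s x" if "x \<in> topspace X" "k' x = k x" for x
    using coord(2)[of x] that by (auto simp: s'_def)
  have "continuous_map X P s'"
  proof (rule pasting_lemma[where I = "{True, False}" and T = "\<lambda>b. if b then W else topspace X - C"
        and f = "\<lambda>b. if b then (\<lambda>x. \<Psi> (k' x, \<phi> (s x))) else s"])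
    show "openin X (if b then W else topspace X - C)" for b using W C by auto
    show "continuous_map (subtopology X (if b then W else topspace X - C)) P
        (if b then \<lambda>x. \<Psi> (k' x, \<phi> (s x)) else s)" for b
      using lW s by (auto simp: lifts_def continuous_map_from_subtopology)
    show "(if i then \<lambda>x. \<Psi> (k' x, \<phi> (s x)) else s) x = (if j then \<lambda>x. \<Psi> (k' x, \<phi> (s x)) else s) x"
      if "x \<in> topspace X \<inter> (if i then W else topspace X - C) \<inter> (if j then W else topspace X - C)"
      for i j x
      using that eq[of x] coord(2)[of x] by (auto split: if_splits)
    show "\<exists>j. j \<in> {True, False} \<and> x \<in> (if j then W else topspace X - C) \<and>
        s' x = (if j then \<lambda>x. \<Psi> (k' x, \<phi> (s x)) else s) x" if "x \<in> topspace X" for x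
      using that CW by (cases "x \<in> W") (auto simp: s'_def)
  qed
  moreover have "\<pi> (s' x) = k' x" if "x \<in> topspace X" for x
  proof (cases "x \<in> W")
    case True
    then show ?thesis using lW that by (simp add: s'_def lifts_def)
  next
    case False
    then have "x \<notin> C" using CW by blast
    then show ?thesis using False s eq[of x] that by (simp add: s'_def lifts_def)
  qed
  ultimately show ?thesis using same unfolding lifts_def by blast
qed

text \<open>Both plateaus matter: finitely many sets \<open>N\<close> will cover the space, and the
  closed set \<open>C\<close> is where \<open>lift_move\<close> may change the base map.\<close>

lemma bump_function:
  assumes X: "normal_space X" "Hausdorff_space X" and W: "openin X W" "x \<in> W"
  shows "\<exists>(v :: 'a \<Rightarrow> real) N C. continuous_map X euclideanreal v \<and>
    (\<forall>y\<in>topspace X. 0 \<le> v y \<and> v y \<le> 1) \<and> openin X N \<and> x \<in> N \<and> (\<forall>y\<in>N. v y = 1) \<and>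
    closedin X C \<and> C \<subseteq> W \<and> (\<forall>y\<in>topspace X - C. v y = 0)"
proof -
  have x: "x \<in> topspace X" using W openin_subset by blast
  have cx: "closedin X {x}" by (simp add: X(2) closedin_Hausdorff_sing_eq x)
  have cW: "closedin X (topspace X - W)" using W by blast
  have "disjnt (topspace X - W) {x}" using W by (auto simp: disjnt_def)
  from Urysohn_lemma[OF X(1) cW cx this, of 0 1]
  obtain f where f: "continuous_map X (top_of_set {0..1::real}) f"
      "f ` (topspace X - W) \<subseteq> {0}" "f ` {x} \<subseteq> {1}"
    by auto
  have fc: "continuous_map X euclideanreal f"
    using f(1) by (simp add: continuous_map_in_subtopology)
  show ?thesis
  proof (intro exI conjI)
    \<comment> \<open>A Urysohn function is 1 only at \<open>x\<close> itself. The map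
      \<open>4 * t - 1\<close> takes 1/4 to 0 and 1/2 to 1, so truncating it to the unit interval
      creates the plateaus.\<close>
    show "continuous_map X euclideanreal (\<lambda>y. max 0 (min 1 (4 * f y - 1)))"
      by (intro continuous_intros fc) auto
    show "openin X {y \<in> topspace X. f y \<in> {1/2<..}}"
      using fc by (rule openin_continuous_map_preimage) simp
    show "closedin X {y \<in> topspace X. f y \<in> {1/4..}}"
      using fc by (rule closedin_continuous_map_preimage) simp
    show "{y \<in> topspace X. f y \<in> {1/4..}} \<subseteq> W" using f(2) by fastforce
  qed (use f x in auto)
qed

text \<open>The homotopy is traversed along the graphs of functions \<open>X \<rightarrow> [0,1]\<close>, raised one bump at a
  time. As \<open>lift_move\<close> keeps the fibre coordinate constant, nothing happens over the points where
  the homotopy stands still.\<close>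

lemma lift_along_homotopy:
  assumes triv: "locally_trivial G P B \<pi>"
    and X: "compact_space X" "Hausdorff_space X"
    and H: "continuous_map (prod_topology X (top_of_set {0..1::real})) B H"
    and s: "lifts X P \<pi> (\<lambda>x. H (x, 0)) s"
  shows "\<exists>s'. lifts X P \<pi> (\<lambda>x. H (x, 1)) s' \<and>
    (\<forall>x\<in>topspace X. (\<forall>t\<in>{0..1}. H (x, t) = H (x, 0)) \<longrightarrow> s' x = s x)"
proof -
  have nX: "normal_space X" using X compact_Hausdorff_or_regular_imp_normal_space by blast
  define St where "St = {x \<in> topspace X. \<forall>t\<in>{0..1}. H (x, t) = H (x, 0)}"
  \<comment> \<open>Every lift over the graph of \<open>\<tau>\<close> can be carried to the graph
    of \<open>\<tau>'\<close> with its values on \<open>St\<close> unchanged. Being reflexive and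
    transitive, \<open>T\<close> can be chained over bumps and over time intervals.\<close>
  define T where "T \<tau> \<tau>' \<longleftrightarrow> (\<forall>s. lifts X P \<pi> (\<lambda>x. H (x, \<tau> x)) s \<longrightarrow>
      (\<exists>s'. lifts X P \<pi> (\<lambda>x. H (x, \<tau>' x)) s' \<and> (\<forall>x\<in>St. s' x = s x)))" for \<tau> \<tau>' :: "_ \<Rightarrow> real"
  have T_refl: "T \<tau> \<tau>" for \<tau> by (auto simp: T_def)
  have T_trans: "T \<tau> \<tau>''" if "T \<tau> \<tau>'" "T \<tau>' \<tau>''" for \<tau> \<tau>' \<tau>''
    using that unfolding T_def by metis
  have H_cont: "continuous_map X B (\<lambda>x. H (x, \<tau> x))"
    if "continuous_map X euclideanreal \<tau>" "\<And>x. x \<in> topspace X \<Longrightarrow> \<tau> x \<in> {0..1}" for \<tau>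
  proof -
    have "continuous_map X (prod_topology X (top_of_set {0..1})) (\<lambda>x. (x, \<tau> x))"
      using that by (auto simp: continuous_map_paired continuous_map_in_subtopology)
    from continuous_map_compose[OF this H] show ?thesis by (simp add: o_def)
  qed
  \<comment> \<open>Near time \<open>t\<close> the graph may be changed where \<open>v\<close> is
    nonzero, and the bump has full height on \<open>N\<close>. The window \<open>\<delta>\<close> is
    to be so small that the homotopy stays in one trivializing set over the support of the
    bump.\<close>
  define good where "good t x N \<delta> v \<longleftrightarrow> openin X N \<and> x \<in> N \<and> 0 < \<delta> \<and> continuous_map X euclideanreal v \<and>
      (\<forall>y\<in>topspace X. 0 \<le> v y \<and> v y \<le> 1) \<and> (\<forall>y\<in>N. v y = 1) \<and>
      (\<forall>\<tau> \<tau>'. continuous_map X euclideanreal \<tau> \<longrightarrow> continuous_map X euclideanreal \<tau>' \<longrightarrow>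
        (\<forall>y\<in>topspace X. \<tau> y \<in> {0..1} \<and> \<tau>' y \<in> {0..1} \<and> \<bar>\<tau> y - t\<bar> < \<delta> \<and> \<bar>\<tau>' y - t\<bar> < \<delta>) \<longrightarrow>
        (\<forall>y\<in>topspace X. v y = 0 \<longrightarrow> \<tau>' y = \<tau> y) \<longrightarrow> T \<tau> \<tau>')" for t x N \<delta> v
  have loc: "\<exists>N \<delta> v. good t x N \<delta> v"
    if x: "x \<in> topspace X" and t: "t \<in> {0..1}" for x t
  proof -
    have "H (x, t) \<in> topspace B"
      using continuous_map_image_subset_topspace[OF H] x t by auto
    then obtain V \<Psi> \<phi> where V: "H (x, t) \<in> V" and lt: "local_trivialization G P B \<pi> V \<Psi> \<phi>"
      by (rule locally_trivialE[OF triv])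
    have "openin B V" using lt by (simp add: local_trivialization_def)
    then have opn: "openin (prod_topology X (top_of_set {0..1}))
        {z \<in> topspace (prod_topology X (top_of_set {0..1})). H z \<in> V}"
      by (rule openin_continuous_map_preimage[OF H])
    have mem: "(x, t) \<in> {z \<in> topspace (prod_topology X (top_of_set {0..1})). H z \<in> V}"
      using x t V by simp
    from openin_prod_topology_alt[THEN iffD1, rule_format, OF opn mem] obtain W J where W: "openin X W" "x \<in> W" and J: "openin (top_of_set {0..1}) J" "t \<in> J"
      and WJ: "W \<times> J \<subseteq> {z \<in> topspace (prod_topology X (top_of_set {0..1})). H z \<in> V}"
      by (elim exE conjE)
    obtain \<delta> where \<delta>: "\<delta> > 0" "ball t \<delta> \<inter> {0..1} \<subseteq> J"
      using J by (metis openin_contains_ball)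
    obtain v :: "_ \<Rightarrow> real" and N C where v: "continuous_map X euclideanreal v"
        "\<forall>y\<in>topspace X. 0 \<le> v y \<and> v y \<le> 1"
      and N: "openin X N" "x \<in> N" "\<forall>y\<in>N. v y = 1"
      and C: "closedin X C" "C \<subseteq> W" "\<forall>y\<in>topspace X - C. v y = 0"
      using bump_function[OF nX X(2) W] by (elim exE conjE)
    have "T \<tau> \<tau>'" if c: "continuous_map X euclideanreal \<tau>" "continuous_map X euclideanreal \<tau>'"
      and r: "\<forall>y\<in>topspace X. \<tau> y \<in> {0..1} \<and> \<tau>' y \<in> {0..1} \<and> \<bar>\<tau> y - t\<bar> < \<delta> \<and> \<bar>\<tau>' y - t\<bar> < \<delta>"
      and z: "\<forall>y\<in>topspace X. v y = 0 \<longrightarrow> \<tau>' y = \<tau> y" for \<tau> \<tau>'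
      unfolding T_def
    proof (intro allI impI)
      fix s assume s: "lifts X P \<pi> (\<lambda>x. H (x, \<tau> x)) s"
      have inV: "H (y, q) \<in> V" if "y \<in> C" "q \<in> {0..1}" "\<bar>q - t\<bar> < \<delta>" for y q
      proof -
        have "q \<in> J" using \<delta>(2) that by (auto simp: dist_real_def)
        then show ?thesis using WJ C(2) that(1) by blast
      qed
      have CX: "C \<subseteq> topspace X" using C(1) closedin_subset by blast
      have V1: "(\<lambda>x. H (x, \<tau> x)) ` C \<subseteq> V" and V2: "(\<lambda>x. H (x, \<tau>' x)) ` C \<subseteq> V"
        using inV r CX by auto
      have eq: "H (y, \<tau>' y) = H (y, \<tau> y)" if "y \<in> topspace X - C" for y
        using z C(3) that by simp
      have Hc: "continuous_map X B (\<lambda>x. H (x, \<tau> x))" "continuous_map X B (\<lambda>x. H (x, \<tau>' x))"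
        using H_cont c r by auto
      have "\<exists>s'. lifts X P \<pi> (\<lambda>x. H (x, \<tau>' x)) s' \<and>
          (\<forall>y\<in>topspace X. H (y, \<tau>' y) = H (y, \<tau> y) \<longrightarrow> s' y = s y)"
        by (rule lift_move[OF lt Hc s C(1) V1 V2]) (rule eq)
      then obtain s' where s': "lifts X P \<pi> (\<lambda>x. H (x, \<tau>' x)) s'"
        "\<forall>y\<in>topspace X. H (y, \<tau>' y) = H (y, \<tau> y) \<longrightarrow> s' y = s y"
        by (elim exE conjE)
      have "s' y = s y" if "y \<in> St" for y
      proof (rule s'(2)[rule_format])
        have y: "y \<in> topspace X" and st: "\<And>t. t \<in> {0..1} \<Longrightarrow> H (y, t) = H (y, 0)"
          using that unfolding St_def by blast+
        show "y \<in> topspace X" by (rule y)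
        show "H (y, \<tau>' y) = H (y, \<tau> y)" using st[of "\<tau>' y"] st[of "\<tau> y"] r y by simp
      qed
      then show "\<exists>s'. lifts X P \<pi> (\<lambda>x. H (x, \<tau>' x)) s' \<and> (\<forall>x\<in>St. s' x = s x)"
        using s'(1) by blast
    qed
    then have "good t x N \<delta> v" using \<delta>(1) v N unfolding good_def by simp
    then show ?thesis by (intro exI)
  qed
  \<comment> \<open>\<open>Bolzano\<close> also presents intervals around \<open>t\<close> that
    leave the unit interval; the guard makes the claim vacuous for them.\<close>
  define T' where "T' a b \<longleftrightarrow> (0 \<le> a \<and> b \<le> 1 \<longrightarrow> T (\<lambda>_. a) (\<lambda>_. b))" for a b
  have "(0::real) \<le> 1" by simp
  then have "T' 0 1"
  proof (induction rule: Bolzano)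
    case (trans a b c)
    then show ?case unfolding T'_def by (auto intro: T_trans)
  next
    case (local t)
    then have "t \<in> {0..1}" by simp
    then have "\<forall>x\<in>topspace X. \<exists>N \<delta> v. good t x N \<delta> v" using loc by simp
    then obtain N \<delta> v where good: "\<And>x. x \<in> topspace X \<Longrightarrow> good t x (N x) (\<delta> x) (v x)"
      by metis
    have N: "openin X (N x) \<and> x \<in> N x \<and> 0 < \<delta> x"
      and v: "continuous_map X euclideanreal (v x) \<and>
        (\<forall>y\<in>topspace X. 0 \<le> v x y \<and> v x y \<le> 1) \<and> (\<forall>y\<in>N x. v x y = 1)"
      if "x \<in> topspace X" for x
      using good[OF that] unfolding good_def by simp_all
    have step: "T \<tau> \<tau>'" if "x \<in> topspace X" "continuous_map X euclideanreal \<tau>" "continuous_map X euclideanreal \<tau>'"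
        "\<forall>y\<in>topspace X. \<tau> y \<in> {0..1} \<and> \<tau>' y \<in> {0..1} \<and> \<bar>\<tau> y - t\<bar> < \<delta> x \<and> \<bar>\<tau>' y - t\<bar> < \<delta> x"
        "\<forall>y\<in>topspace X. v x y = 0 \<longrightarrow> \<tau>' y = \<tau> y" for x \<tau> \<tau>'
      using good[OF that(1)] that(2-) unfolding good_def by (elim conjE) simp
    have "\<exists>F. finite F \<and> F \<subseteq> topspace X \<and> topspace X \<subseteq> (\<Union>x\<in>F. N x)"
    proof -
      have "\<forall>W\<in>N ` topspace X. openin X W" "topspace X \<subseteq> \<Union>(N ` topspace X)"
        using N by auto
      then obtain \<F> where "finite \<F>" "\<F> \<subseteq> N ` topspace X" "topspace X \<subseteq> \<Union>\<F>"
        using X(1) unfolding compact_space_alt by meson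
      then show ?thesis by (metis finite_subset_image)
    qed
    then obtain F where F: "finite F" "F \<subseteq> topspace X" "topspace X \<subseteq> (\<Union>x\<in>F. N x)" by blast
    \<comment> \<open>The inserted 1 keeps the minimum meaningful when \<open>F\<close> is
      empty.\<close>
    define d where "d = Min (insert 1 (\<delta> ` F))"
    have d: "d > 0" "\<And>x. x \<in> F \<Longrightarrow> d \<le> \<delta> x"
      using F N unfolding d_def by auto
    have "T (\<lambda>_. a) (\<lambda>_. b)" if ab: "a \<le> t" "t \<le> b" "b - a < d" "0 \<le> a" "b \<le> 1" for a b
    proof -
      have "\<exists>\<tau>. continuous_map X euclideanreal \<tau> \<and> (\<forall>y\<in>topspace X. a \<le> \<tau> y \<and> \<tau> y \<le> b) \<and>
          (\<forall>x\<in>F'. \<forall>y\<in>N x. \<tau> y = b) \<and> T (\<lambda>_. a) \<tau>" if "F' \<subseteq> F" for F'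
        using finite_subset[OF that F(1)] that
      proof (induction F' rule: finite_induct)
        case empty
        then show ?case using ab T_refl by (intro exI[of _ "\<lambda>_. a"]) auto
      next
        case (insert x F')
        then obtain \<tau> where \<tau>: "continuous_map X euclideanreal \<tau>"
            "\<forall>y\<in>topspace X. a \<le> \<tau> y \<and> \<tau> y \<le> b" "\<forall>x\<in>F'. \<forall>y\<in>N x. \<tau> y = b" "T (\<lambda>_. a) \<tau>"
          by auto
        have x: "x \<in> F" "x \<in> topspace X" using insert F by auto
        have NX: "N z \<subseteq> topspace X" if "z \<in> F" for z
          using N F that openin_subset by blast
        \<comment> \<open>Taking the maximum never lowers the graph, so neighbourhoods that have
          reached height \<open>b\<close> stay there. Where \<open>v x\<close> vanishes the second
          argument is \<open>a\<close>, and since \<open>a\<close> is a lower bound of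
          \<open>\<tau>\<close> the graph is unchanged.\<close>
        define \<tau>' where "\<tau>' y = max (\<tau> y) (a + (b - a) * v x y)" for y
        have c': "continuous_map X euclideanreal \<tau>'" unfolding \<tau>'_def
          using v[OF x(2)] by (intro continuous_intros \<tau>) auto
        have b': "a \<le> \<tau>' y \<and> \<tau>' y \<le> b" if "y \<in> topspace X" for y
        proof -
          have "(b - a) * v x y \<le> (b - a) * 1" using v[OF x(2)] ab that by (intro mult_left_mono) auto
          then show ?thesis using \<tau>(2) that by (auto simp: \<tau>'_def)
        qed
        have e': "\<forall>z\<in>insert x F'. \<forall>y\<in>N z. \<tau>' y = b"
        proof (intro ballI)
          fix z y assume z: "z \<in> insert x F'" and y: "y \<in> N z"
          have "z \<in> F" using z insert by auto
          then have yX: "y \<in> topspace X" using NX y by auto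
          have "\<tau> y \<le> b" using \<tau>(2) yX by auto
          show "\<tau>' y = b"
          proof (cases "z = x")
            case True
            then have "v x y = 1" using v[OF x(2)] y by auto
            with \<open>\<tau> y \<le> b\<close> show ?thesis by (simp add: \<tau>'_def)
          next
            case False
            then have "\<tau> y = b" using z y \<tau>(3) by auto
            then show ?thesis using b'[OF yX] by (simp add: \<tau>'_def)
          qed
        qed
        have "T \<tau> \<tau>'"
        proof (rule step[OF x(2) \<tau>(1) c'])
          show "\<forall>y\<in>topspace X. \<tau> y \<in> {0..1} \<and> \<tau>' y \<in> {0..1} \<and> \<bar>\<tau> y - t\<bar> < \<delta> x \<and> \<bar>\<tau>' y - t\<bar> < \<delta> x"
          proof
            fix y assume y: "y \<in> topspace X"
            show "\<tau> y \<in> {0..1} \<and> \<tau>' y \<in> {0..1} \<and> \<bar>\<tau> y - t\<bar> < \<delta> x \<and> \<bar>\<tau>' y - t\<bar> < \<delta> x"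
              using bspec[OF \<tau>(2) y] b'[OF y] ab d(2)[OF x(1)] by (auto simp: abs_if)
          qed
          show "\<forall>y\<in>topspace X. v x y = 0 \<longrightarrow> \<tau>' y = \<tau> y"
            using \<tau>(2) by (auto simp: \<tau>'_def)
        qed
        then have "T (\<lambda>_. a) \<tau>'" using T_trans \<tau>(4) by blast
        then show ?case using c' b' e' by blast
      qed
      from this[OF subset_refl] obtain \<tau> where
        \<tau>: "\<forall>x\<in>F. \<forall>y\<in>N x. \<tau> y = b" "T (\<lambda>_. a) \<tau>" by blast
      have end_b: "\<tau> y = b" if "y \<in> topspace X" for y using F(3) \<tau>(1) that by auto
      have "T \<tau> (\<lambda>_. b)" unfolding T_def
      proof (intro allI impI exI conjI ballI)
        show "lifts X P \<pi> (\<lambda>x. H (x, b)) s" if "lifts X P \<pi> (\<lambda>x. H (x, \<tau> x)) s" for s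
          using that by (rule lifts_cong) (simp add: end_b)
      qed (rule refl)
      with \<tau>(2) show ?thesis by (rule T_trans)
    qed
    then show ?case using d(1) by (intro exI[of _ d]) (simp add: T'_def)
  qed
  then have "T (\<lambda>_. 0) (\<lambda>_. 1)" by (simp add: T'_def)
  then have "\<exists>s'. lifts X P \<pi> (\<lambda>x. H (x, 1)) s' \<and> (\<forall>x\<in>St. s' x = s x)"
    using s unfolding T_def by simp
  then obtain s' where s': "lifts X P \<pi> (\<lambda>x. H (x, 1)) s'" "\<forall>x\<in>St. s' x = s x"
    by (elim exE conjE)
  have "s' x = s x" if "x \<in> topspace X" "\<forall>t\<in>{0..1}. H (x, t) = H (x, 0)" for x
  proof -
    have "x \<in> St" unfolding St_def using that by blast
    then show ?thesis using s'(2) by blast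
  qed
  with s'(1) show ?thesis by (intro exI[of _ s'] conjI ballI impI)
qed

section \<open>Lifts over a compact manifold, disc by disc\<close>

lemma homeomorphic_map_inverse:
  assumes "homeomorphic_map X Y f"
  shows "\<exists>g. continuous_map X Y f \<and> continuous_map Y X g \<and>
    (\<forall>x\<in>topspace X. g (f x) = x) \<and> (\<forall>y\<in>topspace Y. f (g y) = y)"
  using assms by (simp add: homeomorphic_map_maps homeomorphic_maps_def)

lemma lifts_closed_Un:
  assumes C: "closedin X C" "lifts (subtopology X C) P \<pi> k s"
    and K: "closedin X K" "lifts (subtopology X K) P \<pi> k s'"
    and eq: "\<And>x. x \<in> C \<inter> K \<Longrightarrow> s x = s' x"
  shows "lifts (subtopology X (C \<union> K)) P \<pi> k (\<lambda>x. if x \<in> C then s x else s' x)"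
proof -
  have sub: "C \<subseteq> topspace X" "K \<subseteq> topspace X" using C K closedin_subset by auto
  have "continuous_map (subtopology X (C \<union> K)) P (\<lambda>x. if x \<in> C then s x else s' x)"
  proof (rule pasting_lemma_closed[where I = "{True, False}" and T = "\<lambda>b. if b then C else K"
        and f = "\<lambda>b. if b then s else s'"])
    show "closedin (subtopology X (C \<union> K)) (if b then C else K)" for b
      using C(1) K(1) by (auto intro: closedin_subset_topspace)
    have "(C \<union> K) \<inter> C = C" "(C \<union> K) \<inter> K = K" by auto
    then show "continuous_map (subtopology (subtopology X (C \<union> K)) (if b then C else K)) P
        (if b then s else s')" for b
      using C(2) K(2) by (auto simp: subtopology_subtopology lifts_def)
  qed (use eq in \<open>auto split: if_splits\<close>)
  then show ?thesis using C(2) K(2) sub by (auto simp: lifts_def)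
qed

text \<open>In a local trivialization this amounts to extending a map into the fibre from a closed subset
  of the coordinate ball.\<close>

lemma lift_extend_chart_ball:
  fixes F :: "'e::euclidean_space \<Rightarrow> 'x"
  assumes triv: "locally_trivial G P B \<pi>" and X: "Hausdorff_space X"
    and k: "continuous_map X B k"
    and W: "open W" "openin X (F ` W)" and F: "homeomorphic_map (top_of_set W) (subtopology X (F ` W)) F"
    and x: "x \<in> F ` W"
    and ext: "\<And>(c::'e) r A f. \<lbrakk>closed A; A \<subseteq> cball c r; continuous_map (top_of_set A) G f\<rbrakk> \<Longrightarrow>
      \<exists>g. continuous_map (top_of_set (cball c r)) G g \<and> (\<forall>x\<in>A. g x = f x)"
  shows "\<exists>N K. openin X N \<and> x \<in> N \<and> N \<subseteq> K \<and> closedin X K \<and>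
    (\<forall>C s. closedin X C \<longrightarrow> lifts (subtopology X C) P \<pi> k s \<longrightarrow>
      (\<exists>s'. lifts (subtopology X (C \<union> K)) P \<pi> k s'))"
proof -
  have FX: "F ` W \<subseteq> topspace X" using W(2) openin_subset by blast
  then have tF: "topspace (subtopology X (F ` W)) = F ` W" by auto
  obtain F' where Fc: "continuous_map (top_of_set W) (subtopology X (F ` W)) F"
    and F'c: "continuous_map (subtopology X (F ` W)) (top_of_set W) F'"
    and F'F: "\<forall>w\<in>W. F' (F w) = w" and FF': "\<forall>y\<in>F ` W. F (F' y) = y"
    using homeomorphic_map_inverse[OF F] unfolding tF topspace_euclidean_subtopology by (elim exE conjE)
  have Fc: "continuous_map (top_of_set W) X F"
    using Fc continuous_map_into_fulltopology by blast
  obtain w0 where w0: "w0 \<in> W" "F w0 = x" using x by blast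
  have xX: "x \<in> topspace X" using x FX by blast
  then have "k x \<in> topspace B" using continuous_map_image_subset_topspace[OF k] by blast
  then obtain V \<Psi> \<phi> where V: "k x \<in> V" and lt: "local_trivialization G P B \<pi> V \<Psi> \<phi>"
    by (rule locally_trivialE[OF triv])
  have oV: "openin B V" using lt by (simp add: local_trivialization_def)
  have "continuous_map (top_of_set W) B (k \<circ> F)" by (rule continuous_map_compose[OF Fc k])
  from openin_continuous_map_preimage[OF this oV]
  have "openin (top_of_set W) {w \<in> W. k (F w) \<in> V}" by simp
  then have "open {w \<in> W. k (F w) \<in> V}" using W(1) by (metis openin_open_eq)
  moreover have "w0 \<in> {w \<in> W. k (F w) \<in> V}" using w0 V by simp
  ultimately obtain r where r: "r > 0" "cball w0 r \<subseteq> {w \<in> W. k (F w) \<in> V}"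
    by (meson open_contains_cball)
  define D where "D = cball w0 r"
  have DW: "D \<subseteq> W" and DV: "\<And>w. w \<in> D \<Longrightarrow> k (F w) \<in> V" using r(2) by (auto simp: D_def)
  \<comment> \<open>The image of the closed ball is compact, hence closed in the Hausdorff space
    \<open>X\<close>; the open ball supplies the neighbourhood \<open>N\<close> for a finite
    cover.\<close>
  have "compactin (top_of_set W) D"
    using DW by (simp add: compactin_subtopology D_def)
  then have "compactin X (F ` D)" by (rule image_compactin[OF _ Fc])
  then have K: "closedin X (F ` D)" by (rule compactin_imp_closedin[OF X])
  have "openin (top_of_set W) (ball w0 r)"
    using DW by (simp add: D_def openin_open_eq[OF W(1)]) (meson ball_subset_cball order_trans)
  then have "openin (subtopology X (F ` W)) (F ` ball w0 r)"
    using homeomorphic_imp_open_map[OF F] unfolding open_map_def by blast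
  then have N: "openin X (F ` ball w0 r)" using W(2) openin_trans_full by blast
  have KF: "F ` D \<subseteq> topspace X" using K closedin_subset by blast
  have ex: "\<exists>s'. lifts (subtopology X (C \<union> F ` D)) P \<pi> k s'"
    if C: "closedin X C" and s: "lifts (subtopology X C) P \<pi> k s" for C s
  proof -
    \<comment> \<open>The preimage of \<open>C\<close> is closed only relative to \<open>W\<close>.
      Cutting it with the closed ball \<open>D\<close> inside \<open>W\<close> gives a closed set of
      the Euclidean space, as \<open>ext\<close> requires.\<close>
    have "closedin (top_of_set W) {w \<in> W. F w \<in> C}"
      using closedin_continuous_map_preimage[OF Fc C] by simp
    then obtain Z where Z: "closed Z" "{w \<in> W. F w \<in> C} = W \<inter> Z"
      by (metis closedin_closed)
    define A where "A = D \<inter> Z"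
    have A: "closed A" "A \<subseteq> cball w0 r" using Z(1) by (auto simp: A_def D_def)
    have A_iff: "w \<in> A \<longleftrightarrow> w \<in> D \<and> F w \<in> C" for w
      using Z(2) DW unfolding A_def by blast
    have "continuous_map (top_of_set A) X F"
      using Fc DW A_iff by (meson continuous_map_from_subtopology_mono subset_eq)
    then have FA: "continuous_map (top_of_set A) (subtopology X C) F"
      using A_iff by (auto simp: continuous_map_in_subtopology)
    note sA = lifts_compose[OF s FA]
    have kA: "(\<lambda>w. k (F w)) ` topspace (top_of_set A) \<subseteq> V" using A_iff DV by auto
    note coord = local_trivialization_coordinate[OF lt sA kA]
    obtain g where g: "continuous_map (top_of_set D) G g" "\<forall>w\<in>A. g w = \<phi> (s (F w))"
      using ext[OF A coord(1)] unfolding D_def by (elim exE conjE)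
    have "continuous_map (subtopology X (F ` D)) (top_of_set W) F'"
      using F'c DW by (meson continuous_map_from_subtopology_mono image_mono)
    then have "continuous_map (subtopology X (F ` D)) (top_of_set D) F'"
      using F'F DW by (auto simp: continuous_map_in_subtopology subset_eq)
    from continuous_map_compose[OF this g(1)]
    have gF': "continuous_map (subtopology X (F ` D)) G (\<lambda>y. g (F' y))" by (simp add: o_def)
    have kK: "continuous_map (subtopology X (F ` D)) B k"
      using k by (rule continuous_map_from_subtopology)
    have kV: "k ` topspace (subtopology X (F ` D)) \<subseteq> V" using DV by auto
    note lK = local_trivialization_point[OF lt kK kV gF']
    have eq: "s y = \<Psi> (k y, g (F' y))" if y: "y \<in> C \<inter> F ` D" for y
    proof -
      obtain w where w: "w \<in> D" "y = F w" using y by blast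
      then have "w \<in> A" using y A_iff by blast
      then have "\<Psi> (k (F w), \<phi> (s (F w))) = s (F w)" using coord(2) by simp
      moreover have "F' y = w" using F'F w DW by blast
      ultimately show ?thesis using g(2) \<open>w \<in> A\<close> w(2) by simp
    qed
    show ?thesis by (rule exI, rule lifts_closed_Un[OF C s K lK], rule eq)
  qed
  show ?thesis
  proof (rule exI[of _ "F ` ball w0 r"], rule exI[of _ "F ` D"], intro conjI allI impI)
    show "openin X (F ` ball w0 r)" "closedin X (F ` D)" by fact+
    show "x \<in> F ` ball w0 r" using w0 r(1) by auto
    show "F ` ball w0 r \<subseteq> F ` D" unfolding D_def by auto
    show "\<exists>s'. lifts (subtopology X (C \<union> F ` D)) P \<pi> k s'"
      if "closedin X C" "lifts (subtopology X C) P \<pi> k s" for C s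
      using that by (rule ex)
  qed
qed

text \<open>\<open>ext\<close> isolates the only property of the fibre that enters, namely extension
  over balls of the dimension of the manifold.\<close>

lemma lift_over_compact_manifold:
  assumes triv: "locally_trivial G P B \<pi>" and X: "compact_space X" "Hausdorff_space X"
    and k: "continuous_map X B k"
    and charts: "\<And>x. x \<in> topspace X \<Longrightarrow> \<exists>W (F :: 'e::euclidean_space \<Rightarrow> 'x). open W \<and>
      openin X (F ` W) \<and> homeomorphic_map (top_of_set W) (subtopology X (F ` W)) F \<and> x \<in> F ` W"
    and ext: "\<And>(c::'e) r A f. \<lbrakk>closed A; A \<subseteq> cball c r; continuous_map (top_of_set A) G f\<rbrakk> \<Longrightarrow>
      \<exists>g. continuous_map (top_of_set (cball c r)) G g \<and> (\<forall>x\<in>A. g x = f x)"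
  shows "\<exists>s. lifts X P \<pi> k s"
proof -
  \<comment> \<open>\<open>K\<close> is chosen before \<open>C\<close> and \<open>s\<close>, so a
    finite cover can be fixed first and its members adjoined in any order.\<close>
  define good where "good x N K \<longleftrightarrow> openin X N \<and> x \<in> N \<and> N \<subseteq> K \<and> closedin X K \<and>
    (\<forall>C s. closedin X C \<longrightarrow> lifts (subtopology X C) P \<pi> k s \<longrightarrow>
      (\<exists>s'. lifts (subtopology X (C \<union> K)) P \<pi> k s'))" for x N K
  have "\<exists>N K. good x N K" if "x \<in> topspace X" for x
  proof -
    obtain W and F :: "'e \<Rightarrow> 'x" where *: "open W" "openin X (F ` W)"
        "homeomorphic_map (top_of_set W) (subtopology X (F ` W)) F" "x \<in> F ` W"
      using charts[OF \<open>x \<in> topspace X\<close>] by (elim exE conjE)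
    show ?thesis unfolding good_def by (rule lift_extend_chart_ball[OF triv X(2) k * ext])
  qed
  then obtain N K where good: "\<And>x. x \<in> topspace X \<Longrightarrow> good x (N x) (K x)" by metis
  have N: "openin X (N x)" "x \<in> N x" "N x \<subseteq> K x" "closedin X (K x)" if "x \<in> topspace X" for x
    using good[OF that] unfolding good_def by simp_all
  have step: "\<exists>s'. lifts (subtopology X (C \<union> K x)) P \<pi> k s'"
    if "x \<in> topspace X" "closedin X C" "lifts (subtopology X C) P \<pi> k s" for x C s
  proof -
    have "\<forall>C s. closedin X C \<longrightarrow> lifts (subtopology X C) P \<pi> k s \<longrightarrow>
        (\<exists>s'. lifts (subtopology X (C \<union> K x)) P \<pi> k s')"
      using good[OF that(1)] unfolding good_def by (elim conjE)
    from this[rule_format, OF that(2,3)] show ?thesis .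
  qed
  have "\<forall>W\<in>N ` topspace X. openin X W" "topspace X \<subseteq> \<Union>(N ` topspace X)"
    using N by auto
  then obtain \<F> where "finite \<F>" "\<F> \<subseteq> N ` topspace X" "topspace X \<subseteq> \<Union>\<F>"
    using X(1) unfolding compact_space_alt by meson
  then obtain F where F: "finite F" "F \<subseteq> topspace X" "topspace X \<subseteq> (\<Union>x\<in>F. N x)"
    by (metis finite_subset_image)
  have "\<exists>s. lifts (subtopology X (\<Union>x\<in>F'. K x)) P \<pi> k s" if "F' \<subseteq> F" for F'
    using finite_subset[OF that F(1)] that
  proof (induction F' rule: finite_induct)
    case empty
    show ?case by (simp add: lifts_def)
  next
    case (insert x F')
    then obtain s where s: "lifts (subtopology X (\<Union>x\<in>F'. K x)) P \<pi> k s" by auto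
    have "closedin X (\<Union>x\<in>F'. K x)" using insert N(4) F(2) by (intro closedin_Union) auto
    moreover have "x \<in> topspace X" using insert F(2) by auto
    ultimately show ?case using step[OF _ _ s, of x] by (simp add: Un_commute)
  qed
  from this[OF subset_refl] obtain s where s: "lifts (subtopology X (\<Union>x\<in>F. K x)) P \<pi> k s" ..
  have "topspace X \<subseteq> (\<Union>x\<in>F. K x)" using F N(3) by blast
  then have "subtopology X (\<Union>x\<in>F. K x) = X" by (simp add: subtopology_superset)
  with s show ?thesis by auto
qed

section \<open>From compact convex sets to the open rectangle\<close>

text \<open>A lift over \<open>X \<times> K\<close> is pulled back along the nearest point projection onto \<open>K\<close> and then
  moved along the straight-line homotopy to the identity, which is constant over \<open>X \<times> K\<close>.\<close>

lemma lift_extend_convex: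
  fixes K L Q :: "'e::euclidean_space set"
  assumes triv: "locally_trivial G P B \<pi>" and X: "compact_space X" "Hausdorff_space X"
    and K: "compact K" "convex K" "K \<noteq> {}" and L: "compact L" "convex L" "K \<subseteq> L" "L \<subseteq> Q"
    and k: "continuous_map (prod_topology X (top_of_set Q)) B k"
    and s: "lifts (prod_topology X (top_of_set K)) P \<pi> k s"
  shows "\<exists>s'. lifts (prod_topology X (top_of_set L)) P \<pi> k s' \<and>
    (\<forall>x\<in>topspace X. \<forall>v\<in>K. s' (x, v) = s (x, v))"
proof -
  let ?Y = "prod_topology X (top_of_set L)"
  define p where "p = closest_point K"
  have clK: "closed K" using K(1) compact_imp_closed by blast
  have p_in: "p v \<in> K" for v
    unfolding p_def by (rule closest_point_in_set[OF clK K(3)])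
  have p_id: "p v = v" if "v \<in> K" for v
    unfolding p_def by (rule closest_point_self[OF that])
  have p_cont: "continuous_on Z p" for Z
    unfolding p_def by (rule continuous_on_closest_point[OF K(2) clK K(3)])
  define h where "h v t = (1 - t) *\<^sub>R p v + t *\<^sub>R v" for v and t :: real
  have h_in: "h v t \<in> L" if "v \<in> L" "t \<in> {0..1}" for v t
    unfolding h_def using that p_in[of v] L(3) by (intro convexD[OF L(2)]) auto
  define H where "H z = k (fst (fst z), h (snd (fst z)) (snd z))" for z
  \<comment> \<open>Compactness of \<open>L\<close> enters here: \<open>lift_along_homotopy\<close>
    is applied with \<open>?Y\<close> as its parameter space.\<close>
  have Y: "compact_space ?Y" "Hausdorff_space ?Y"
    using X L(1) by (auto simp: compact_space_prod_topology compact_space_subtopology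
        Hausdorff_space_prod_topology Hausdorff_space_subtopology)
  have c1: "continuous_map (prod_topology ?Y (top_of_set {0..1::real})) X (\<lambda>z. fst (fst z))"
    using continuous_map_compose[OF continuous_map_fst continuous_map_fst] by (simp add: o_def)
  have c2: "continuous_map (prod_topology ?Y (top_of_set {0..1::real})) (top_of_set L) (\<lambda>z. snd (fst z))"
    using continuous_map_compose[OF continuous_map_fst continuous_map_snd] by (simp add: o_def)
  have c3: "continuous_map (prod_topology ?Y (top_of_set {0..1::real})) (top_of_set (L \<times> {0..1}))
      (\<lambda>z. (snd (fst z), snd z))"
    unfolding prod_topology_subtopology_eu[symmetric]
    using c2 by (intro continuous_map_pairedI continuous_map_snd)
  have "continuous_on (L \<times> {0..1}) (\<lambda>w. h (fst w) (snd w))"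
    unfolding h_def
    by (intro continuous_intros continuous_on_compose2[OF p_cont[of UNIV]]) auto
  then have "continuous_map (top_of_set (L \<times> {0..1})) (top_of_set Q) (\<lambda>w. h (fst w) (snd w))"
    using h_in L(4) by (auto simp: continuous_map_in_subtopology)
  from continuous_map_compose[OF c3 this]
  have "continuous_map (prod_topology ?Y (top_of_set {0..1::real})) (top_of_set Q)
      (\<lambda>z. h (snd (fst z)) (snd z))"
    by (simp add: o_def)
  with c1 have "continuous_map (prod_topology ?Y (top_of_set {0..1::real}))
      (prod_topology X (top_of_set Q)) (\<lambda>z. (fst (fst z), h (snd (fst z)) (snd z)))"
    by (rule continuous_map_pairedI)
  from continuous_map_compose[OF this k]
  have H: "continuous_map (prod_topology ?Y (top_of_set {0..1::real})) B H"
    by (simp add: H_def[abs_def] o_def)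
  have "continuous_map (top_of_set L) (top_of_set K) p"
    using p_cont p_in by (auto simp: continuous_map_in_subtopology)
  then have "continuous_map ?Y (prod_topology X (top_of_set K)) (\<lambda>y. (fst y, p (snd y)))"
    using continuous_map_compose[OF continuous_map_snd, of "top_of_set L" "top_of_set K" p X]
    by (intro continuous_map_pairedI continuous_map_fst) (simp add: o_def)
  from lifts_compose[OF s this]
  have s0: "lifts ?Y P \<pi> (\<lambda>y. H (y, 0)) (\<lambda>y. s (fst y, p (snd y)))"
    by (simp add: H_def h_def)
  obtain s' where s': "lifts ?Y P \<pi> (\<lambda>y. H (y, 1)) s'"
    "\<forall>y\<in>topspace ?Y. (\<forall>t\<in>{0..1}. H (y, t) = H (y, 0)) \<longrightarrow> s' y = s (fst y, p (snd y))"
    using lift_along_homotopy[OF triv Y H s0] by (elim exE conjE)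
  show ?thesis
  proof (intro exI conjI ballI)
    show "lifts ?Y P \<pi> k s'" using s'(1) by (simp add: H_def h_def)
    show "s' (x, v) = s (x, v)" if "x \<in> topspace X" "v \<in> K" for x v
    proof -
      have "h v t = v" for t
        using that(2) by (simp add: h_def p_id flip: scaleR_left_distrib)
      then have "H ((x, v), t) = H ((x, v), 0)" for t by (simp add: H_def)
      moreover have "(x, v) \<in> topspace ?Y" using that L(3) by auto
      ultimately have "s' (x, v) = s (fst (x, v), p (snd (x, v)))" using s'(2) by blast
      then show ?thesis using p_id[OF that(2)] by simp
    qed
  qed
qed

text \<open>Each extension keeps the earlier values, so at every point the sequence of lifts is
  eventually constant. Its limit is continuous because each point is interior to some stage, where
  the limit coincides with a single lift.\<close>

lemma lift_over_exhaustion: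
  fixes R :: "nat \<Rightarrow> 'e::euclidean_space set"
  assumes triv: "locally_trivial G P B \<pi>" and X: "compact_space X" "Hausdorff_space X"
    and R: "\<And>n. compact (R n)" "\<And>n. convex (R n)" "\<And>n. R n \<noteq> {}" "\<And>n. R n \<subseteq> R (Suc n)" "\<And>n. R n \<subseteq> Q"
    and Q: "\<And>v. v \<in> Q \<Longrightarrow> \<exists>n. v \<in> interior (R n)"
    and k: "continuous_map (prod_topology X (top_of_set Q)) B k"
    and s: "lifts (prod_topology X (top_of_set (R 0))) P \<pi> k s"
  shows "\<exists>s. lifts (prod_topology X (top_of_set Q)) P \<pi> k s"
proof -
  let ?L = "\<lambda>n. lifts (prod_topology X (top_of_set (R n))) P \<pi> k"
  have "\<exists>\<sigma>. \<forall>n. ?L n (\<sigma> n) \<and> (\<forall>x\<in>topspace X. \<forall>v\<in>R n. \<sigma> (Suc n) (x, v) = \<sigma> n (x, v))"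
  proof (rule dependent_nat_choice)
    show "\<exists>s. ?L 0 s" using s by blast
    show "\<exists>s'. ?L (Suc n) s' \<and> (\<forall>x\<in>topspace X. \<forall>v\<in>R n. s' (x, v) = s (x, v))"
      if "?L n s" for s n
      by (rule lift_extend_convex[OF triv X R(1) R(2) R(3) R(1) R(2) R(4) R(5) k that])
  qed
  then obtain \<sigma> where \<sigma>: "\<And>n. ?L n (\<sigma> n)"
    and Suc: "\<And>n x v. x \<in> topspace X \<Longrightarrow> v \<in> R n \<Longrightarrow> \<sigma> (Suc n) (x, v) = \<sigma> n (x, v)"
    by metis
  have mono: "R i \<subseteq> R j" if "i \<le> j" for i j
    using lift_Suc_mono_le[of R, OF R(4) that] .
  have le: "\<sigma> j (x, v) = \<sigma> i (x, v)" if "i \<le> j" "x \<in> topspace X" "v \<in> R i" for i j x v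
    using that(1)
  proof (induction j rule: dec_induct)
    case (step j)
    then show ?case using Suc[OF that(2), of v j] mono[of i j] that(3) by auto
  qed simp
  have agree: "\<sigma> j (x, v) = \<sigma> i (x, v)" if "x \<in> topspace X" "v \<in> R i" "v \<in> R j" for i j x v
    using le[of i j x v] le[of j i x v] that by (cases i j rule: le_cases) auto
  \<comment> \<open>Any index serves: by \<open>agree\<close> the value of the glued lift does not
    depend on the choice, which may vary with \<open>v\<close> without regularity.\<close>
  define n where "n v = (SOME n. v \<in> interior (R n))" for v
  have n: "v \<in> interior (R (n v))" if "v \<in> Q" for v
    unfolding n_def using Q[OF that] by (rule someI_ex)
  define s where "s z = \<sigma> (n (snd z)) z" for z
  have intR: "interior (R i) \<subseteq> R i" "interior (R i) \<subseteq> Q" for i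
    using interior_subset R(5) by blast+
  have cont: "continuous_map (prod_topology X (top_of_set Q)) P s"
  proof (rule pasting_lemma[where I = UNIV and T = "\<lambda>i. topspace X \<times> interior (R i)" and f = \<sigma>])
    fix i
    show "openin (prod_topology X (top_of_set Q)) (topspace X \<times> interior (R i))"
      using intR(2)[of i] by (simp add: openin_prod_Times_iff open_subset)
    have "continuous_map (prod_topology X (top_of_set (R i))) P (\<sigma> i)"
      using \<sigma>[of i] by (simp add: lifts_def)
    then have "continuous_map (prod_topology X (top_of_set (interior (R i)))) P (\<sigma> i)"
      using intR(1)[of i] unfolding prod_topology_subtopology(2)
      by (meson Sigma_mono continuous_map_from_subtopology_mono subset_refl)
    moreover have "subtopology (prod_topology X (top_of_set Q)) (topspace X \<times> interior (R i))
        = prod_topology X (top_of_set (interior (R i)))"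
      using intR(2)[of i] by (simp add: subtopology_Times subtopology_subtopology inf.absorb2)
    ultimately show "continuous_map (subtopology (prod_topology X (top_of_set Q))
        (topspace X \<times> interior (R i))) P (\<sigma> i)" by simp
  next
    fix i j z
    assume "z \<in> topspace (prod_topology X (top_of_set Q)) \<inter> topspace X \<times> interior (R i)
      \<inter> topspace X \<times> interior (R j)"
    then show "\<sigma> i z = \<sigma> j z" using agree intR(1) by (cases z) blast
  next
    fix z assume z: "z \<in> topspace (prod_topology X (top_of_set Q))"
    then show "\<exists>j. j \<in> UNIV \<and> z \<in> topspace X \<times> interior (R j) \<and> s z = \<sigma> j z"
      using n[of "snd z"] by (intro exI[of _ "n (snd z)"]) (auto simp: s_def mem_Times_iff)
  qed
  have "\<pi> (s z) = k z" if "z \<in> topspace (prod_topology X (top_of_set Q))" for z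
  proof -
    have "z \<in> topspace (prod_topology X (top_of_set (R (n (snd z)))))"
      using that n[of "snd z"] intR(1) by (auto simp: mem_Times_iff)
    then show ?thesis using \<sigma>[of "n (snd z)"] unfolding lifts_def s_def by blast
  qed
  with cont show ?thesis unfolding lifts_def by blast
qed

lemma lift_over_open_box:
  fixes a :: "'e::euclidean_space"
  assumes triv: "locally_trivial G P B \<pi>" and X: "compact_space X" "Hausdorff_space X"
    and a: "\<And>b. b \<in> Basis \<Longrightarrow> a \<bullet> b > 0"
    and k: "continuous_map (prod_topology X (top_of_set (box (- a) a))) B k"
    and s: "lifts X P \<pi> (\<lambda>x. k (x, 0)) s"
  shows "\<exists>s. lifts (prod_topology X (top_of_set (box (- a) a))) P \<pi> k s"
proof -
  \<comment> \<open>The factor 0 at the start shrinks the first box to the origin, where a lift is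
    given; factors below 1 keep the closed boxes inside the open one, and the limit 1 makes their
    interiors exhaust it.\<close>
  define c where "c n = real n / real (Suc n)" for n
  have c: "0 \<le> c n" "c n < 1" "c n \<le> c (Suc n)" for n
    by (auto simp: c_def field_simps)
  have c_lim: "c \<longlonglongrightarrow> 1"
    unfolding c_def by (rule LIMSEQ_n_over_Suc_n)
  define R where "R n = cbox (- (c n *\<^sub>R a)) (c n *\<^sub>R a)" for n
  have R_mem: "v \<in> R n \<longleftrightarrow> (\<forall>b\<in>Basis. \<bar>v \<bullet> b\<bar> \<le> c n * (a \<bullet> b))" for v n
    unfolding R_def mem_box by (auto simp: abs_le_iff)
  have int_mem: "v \<in> interior (R n) \<longleftrightarrow> (\<forall>b\<in>Basis. \<bar>v \<bullet> b\<bar> < c n * (a \<bullet> b))" for v n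
    unfolding R_def interior_cbox mem_box by (auto simp: abs_less_iff)
  have box_mem: "v \<in> box (- a) a \<longleftrightarrow> (\<forall>b\<in>Basis. \<bar>v \<bullet> b\<bar> < a \<bullet> b)" for v
    unfolding mem_box by (auto simp: abs_less_iff)
  have R0: "R 0 = {0}" by (simp add: R_def c_def)
  show ?thesis
  proof (rule lift_over_exhaustion[OF triv X, where R = R])
    show "compact (R n)" "convex (R n)" for n by (simp_all add: R_def)
    have "0 \<in> R n" for n using c(1)[of n] a by (simp add: R_mem less_imp_le)
    then show "R n \<noteq> {}" for n by blast
    show "R n \<subseteq> R (Suc n)" for n
    proof
      fix v assume v: "v \<in> R n"
      have "\<bar>v \<bullet> b\<bar> \<le> c (Suc n) * (a \<bullet> b)" if "b \<in> Basis" for b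
      proof -
        have "c n * (a \<bullet> b) \<le> c (Suc n) * (a \<bullet> b)"
          using c(3) a[OF that] by (intro mult_right_mono) auto
        then show ?thesis using v that by (force simp: R_mem)
      qed
      then show "v \<in> R (Suc n)" by (simp add: R_mem)
    qed
    show "R n \<subseteq> box (- a) a" for n
    proof
      fix v assume v: "v \<in> R n"
      have "\<bar>v \<bullet> b\<bar> < a \<bullet> b" if "b \<in> Basis" for b
      proof -
        have "c n * (a \<bullet> b) < 1 * (a \<bullet> b)"
          using c(2) a[OF that] by (intro mult_strict_right_mono) auto
        then show ?thesis using v that by (force simp: R_mem)
      qed
      then show "v \<in> box (- a) a" by (simp add: box_mem)
    qed
    show "\<exists>n. v \<in> interior (R n)" if "v \<in> box (- a) a" for v
    proof -
      have "\<forall>\<^sub>F n in sequentially. \<bar>v \<bullet> b\<bar> < c n * (a \<bullet> b)" if "b \<in> Basis" for b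
      proof (rule order_tendstoD(1))
        show "(\<lambda>n. c n * (a \<bullet> b)) \<longlonglongrightarrow> 1 * (a \<bullet> b)" by (intro tendsto_intros c_lim)
        show "\<bar>v \<bullet> b\<bar> < 1 * (a \<bullet> b)" using \<open>v \<in> box (- a) a\<close> that by (simp add: box_mem)
      qed
      then have "\<forall>\<^sub>F n in sequentially. \<forall>b\<in>Basis. \<bar>v \<bullet> b\<bar> < c n * (a \<bullet> b)"
        by (simp add: eventually_ball_finite)
      then have "\<exists>n. \<forall>b\<in>Basis. \<bar>v \<bullet> b\<bar> < c n * (a \<bullet> b)"
        using eventually_happens' sequentially_bot by blast
      then show ?thesis by (simp add: int_mem)
    qed
    have "lifts (prod_topology X (top_of_set {0})) P \<pi> (\<lambda>y. k (fst y, 0)) (\<lambda>y. s (fst y))"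
      using lifts_compose[OF s continuous_map_fst] .
    then show "lifts (prod_topology X (top_of_set (R 0))) P \<pi> k (\<lambda>y. s (fst y))"
      unfolding R0 by (rule lifts_cong) auto
  qed (rule k)
qed

section \<open>Sections over the neighbourhood of the surface\<close>

theorem theorem3p2:
  fixes M :: "'a topology" and A :: "('a, 4) chart set"
    and g :: "('a, 4) chart \<Rightarrow> 'a \<Rightarrow> real ^ 4 ^ 4"
    and S U :: "'a set" and \<Sigma> :: "real \<Rightarrow> 'a set" and \<epsilon> \<tau> :: real
    and P :: "'p topology" and \<pi> :: "'p \<Rightarrow> 'a" and act :: "'p \<Rightarrow> complex ^ 2 ^ 2 \<Rightarrow> 'p"
  assumes "smooth_manifold M A" and "lorentzian_metric A g"
    and "embedded_submanifold TYPE(2) M A S" and "compactin M S" and "connectedin M S"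
    and "orientable_submanifold TYPE(2) M A S" and "spacelike_submanifold TYPE(2) M A g S"
    and "\<exists>W. openin M W \<and> S \<subseteq> W \<and> time_space_orientable M A g W"
    and "openin M U" and "S \<subseteq> U" and "time_space_orientable M A g U"
    and "\<tau> > 0" and "\<epsilon> > 0"
    and "hypersurface_foliation M A U {-\<tau><..<\<tau>} \<Sigma>"
    and "\<And>t. t \<in> {-\<tau><..<\<tau>} \<Longrightarrow> spacelike_submanifold TYPE(3) M A g (\<Sigma> t)"
    and "\<And>t. t \<in> {-\<tau><..<\<tau>} \<Longrightarrow> subtopology M (\<Sigma> t) homeomorphic_space
           prod_topology (subtopology M S) (top_of_set {-\<epsilon><..<\<epsilon>})"
    and "\<exists>h. homeomorphic_map (prod_topology (subtopology M S) (top_of_set {-\<epsilon><..<\<epsilon>}))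
               (subtopology M (\<Sigma> 0)) h \<and> (\<forall>s\<in>S. h (s, 0) = s)"
    and "subtopology M U homeomorphic_space
           prod_topology (subtopology M S)
             (prod_topology (top_of_set {-\<epsilon><..<\<epsilon>}) (top_of_set {-\<tau><..<\<tau>}))"
    and "SL2C_bundle P (subtopology M U) \<pi> act"
  shows "globally_trivializable P (subtopology M U) \<pi>"
proof -
  let ?X = "subtopology M S" and ?B = "subtopology M U"
  \<comment> \<open>The rectangle is written as a box about the origin of the plane, the form that
    concentric shrinking needs.\<close>
  let ?Q = "box (- (\<epsilon>, \<tau>)) (\<epsilon>, \<tau>)"
  have triv: "locally_trivial (top_of_set SL2C) P ?B \<pi>"
    by (rule principal_bundle_imp_locally_trivial[OF assms(19)])
  have X: "compact_space ?X" "Hausdorff_space ?X"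
    using assms(1,4) by (auto simp: compact_space_subtopology smooth_manifold_def Hausdorff_space_subtopology)
  have Q: "?Q = {-\<epsilon><..<\<epsilon>} \<times> {-\<tau><..<\<tau>}"
    by (simp add: box_prod)
  have "?B homeomorphic_space prod_topology ?X (top_of_set ?Q)"
    unfolding Q using assms(18) by simp
  then obtain \<theta> k where \<theta>: "continuous_map ?B (prod_topology ?X (top_of_set ?Q)) \<theta>"
    and k: "continuous_map (prod_topology ?X (top_of_set ?Q)) ?B k"
    and k\<theta>: "\<forall>x\<in>topspace ?B. k (\<theta> x) = x"
    unfolding homeomorphic_space_def homeomorphic_maps_def by (elim exE conjE)
  have zero: "0 \<in> ?Q" unfolding Q using assms(12,13) by (simp add: zero_prod_def)
  \<comment> \<open>The product homeomorphism is not claimed to send \<open>(x, 0)\<close> to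
    \<open>x\<close>, so the first lift is sought over the central slice \<open>k (x, 0)\<close>
    rather than over the inclusion of the surface.\<close>
  have "continuous_map ?X (prod_topology ?X (top_of_set ?Q)) (\<lambda>x. (x, 0))"
    using zero by (intro continuous_map_pairedI) auto
  from continuous_map_compose[OF this k]
  have k0: "continuous_map ?X ?B (\<lambda>x. k (x, 0))" by (simp add: o_def)
  have "\<exists>s. lifts ?X P \<pi> (\<lambda>x. k (x, 0)) s"
  proof (rule lift_over_compact_manifold[OF triv X k0])
    fix x assume "x \<in> topspace ?X"
    then have "x \<in> S" by simp
    then obtain W and F :: "real ^ 2 \<Rightarrow> 'a" where F: "local_param M A S W F" "x \<in> F ` W"
      using assms(3) unfolding embedded_submanifold_def by blast
    have "openin ?X (F ` W)" using F(1) by (simp add: local_param_def)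
    then have "F ` W \<subseteq> S" using openin_subset by fastforce
    then have "subtopology ?X (F ` W) = subtopology M (F ` W)"
      by (simp add: subtopology_subtopology inf.absorb2)
    then show "\<exists>W (F :: real ^ 2 \<Rightarrow> 'a). open W \<and> openin ?X (F ` W) \<and>
        homeomorphic_map (top_of_set W) (subtopology ?X (F ` W)) F \<and> x \<in> F ` W"
      using F by (intro exI[of _ W] exI[of _ F]) (simp add: local_param_def)
  next
    fix c :: "real ^ 2" and r C f
    assume C: "closed C" "C \<subseteq> cball c r" "continuous_map (top_of_set C) (top_of_set SL2C) f"
    have "DIM(real ^ 2) \<le> 3" by simp
    from SL2C_extension[OF this C(1,2) compact_cball C(3)]
    show "\<exists>g. continuous_map (top_of_set (cball c r)) (top_of_set SL2C) g \<and> (\<forall>x\<in>C. g x = f x)"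
      by metis
  qed
  then obtain s where "lifts ?X P \<pi> (\<lambda>x. k (x, 0)) s" ..
  then have "\<exists>s. lifts (prod_topology ?X (top_of_set ?Q)) P \<pi> k s"
    using assms(12,13) by (intro lift_over_open_box[OF triv X _ k]) (auto simp: Basis_prod_def)
  then obtain \<sigma> where "lifts (prod_topology ?X (top_of_set ?Q)) P \<pi> k \<sigma>" ..
  \<comment> \<open>Since \<open>k\<close> undoes \<open>\<theta>\<close>, precomposing the lift of
    \<open>k\<close> with \<open>\<theta>\<close> gives a lift of the identity, that is, a
    section.\<close>
  from lifts_compose[OF this \<theta>] have "lifts ?B P \<pi> (\<lambda>x. k (\<theta> x)) (\<lambda>x. \<sigma> (\<theta> x))" .
  then show ?thesis unfolding globally_trivializable_def lifts_def using k\<theta>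
    by (intro exI[of _ "\<lambda>x. \<sigma> (\<theta> x)"]) simp
qed

end
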